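(* Let $S\colon\mathcal X\to\mathcal A\times\mathcal B$ be a functor, and put $S_0=Pr_0\cdot S\colon\mathcal X\to\mathcal A$ and $S_1=Pr_1\cdot S\colon\mathcal X\to\mathcal B$, where $Pr_0,Pr_1$ are the product projections. The following statements are equivalent: (i) the span $S$ is regular; (ii) $S\colon(\mathcal X,S_0)\to(\mathcal A\times\mathcal B,Pr_0)$ is a fiberwise opfibration in $\mathbf{Fib}(\mathcal A)$; (iii) $S\colon(\mathcal X,S_1)\to(\mathcal A\times\mathcal B,Pr_1)$ is a fiberwise fibration in $\mathbf{opFib}(\mathcal B)$.
   Context: Let $F\colon\mathcal E\to\mathcal B$ be a functor. An arrow $f$ of $\mathcal E$ is $F$-cartesian if for every arrow $g$ of $\mathcal E$ with the same codomain as $f$ and every arrow $\psi$ of $\mathcal B$ with $F(g)=F(f)\cdot\psi$ there is a unique $h$ with $f\cdot h=g$ and $F(h)=\psi$. An arrow $f$ is $F$-vertical if $F(f)$ is an identity. A cartesian lifting of $\varphi$ at $x$ is an $F$-cartesian arrow $f$ with codomain $x$ and $F(f)=\varphi$. $F$ is a fibration if every arrow $\varphi$ with codomain $F(x)$ has a cartesian lifting at $x$, for every object $x$ of $\mathcal E$. Opcartesian arrows, opcartesian liftings and opfibrations are the dual notions. All (op)fibrations are assumed to admit a cleavage (a choice of (op)cartesian liftings). Regular span: $S$ is regular if (R0) for every object $x'$ of $\mathcal X$ and every arrow $\alpha\colon a\to S_0(x')$ of $\mathcal A$ there is an $S_0$-cartesian arrow $\xi\colon x\to x'$ with $S_0(\xi)=\alpha$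 and $S_1(\xi)=1_{S_1(x')}$; (R1) for every object $x$ of $\mathcal X$ and every arrow $\beta\colon S_1(x)\to b$ of $\mathcal B$ there is an $S_1$-opcartesian arrow $\xi\colon x\to x'$ with $S_1(\xi)=\beta$ and $S_0(\xi)=1_{S_0(x)}$. $\mathbf{Fib}(\mathcal A)$: the objects are fibrations $(\mathcal X,F)$, $F\colon\mathcal X\to\mathcal A$. A morphism $P\colon(\mathcal X,F)\to(\mathcal M,G)$ is a functor $P\colon\mathcal X\to\mathcal M$ with $G\cdot P=F$ sending $F$-cartesian arrows to $G$-cartesian arrows. Dually, $\mathbf{opFib}(\mathcal B)$ has opfibrations over $\mathcal B$ as objects and functors over $\mathcal B$ preserving opcartesian arrows as morphisms. For a functor $F\colon\mathcal X\to\mathcal A$ and an object $a$ of $\mathcal A$, the fiber $\mathcal X_a$ is the subcategory of objects $x$ with $Fx=a$ and arrows $f$ with $Ff=1_a$. A morphism $P\colon(\mathcal X,F)\to(\mathcal M,G)$ of $\mathbf{Fib}(\mathcal A)$ (or of $\mathbf{opFib}(\mathcal A)$) is a fiberwise opfibration (respectively fiberwise fibration) if for every object $a$ of $\mathcal A$ the restriction $P_a\colon\mathcal X_a\to\mathcal M_a$ is an opfibration (respectively a fibration). Statements (ii) and (iii) include the assertion that $S$ is a morphism of $\mathbf{Fib}(\mathcal A)$, respectively of $\mathbf{opFib}(\mathcal B)$. *)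

theory Defs
  imports Main
begin

text \<open>Categories with explicit carriers of objects and arrows; \<open>Comp C f g\<close> is \<open>f \<cdot> g\<close>
  (first \<open>g\<close>, then \<open>f\<close>) and is meaningful only if \<open>Dom C f = Cod C g\<close>.\<close>

record ('o, 'm) cat =
  Obj :: "'o set"
  Arr :: "'m set"
  Dom :: "'m \<Rightarrow> 'o"
  Cod :: "'m \<Rightarrow> 'o"
  Ide :: "'o \<Rightarrow> 'm"
  Comp :: "'m \<Rightarrow> 'm \<Rightarrow> 'm"

locale category =
  fixes C :: "('o, 'm) cat"
  assumes dom_obj: "f \<in> Arr C \<Longrightarrow> Dom C f \<in> Obj C"
    and cod_obj: "f \<in> Arr C \<Longrightarrow> Cod C f \<in> Obj C"
    and ide_arr: "a \<in> Obj C \<Longrightarrow> Ide C a \<in> Arr C"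
    and dom_ide: "a \<in> Obj C \<Longrightarrow> Dom C (Ide C a) = a"
    and cod_ide: "a \<in> Obj C \<Longrightarrow> Cod C (Ide C a) = a"
    and comp_arr: "\<lbrakk>f \<in> Arr C; g \<in> Arr C; Dom C f = Cod C g\<rbrakk> \<Longrightarrow> Comp C f g \<in> Arr C"
    and dom_comp: "\<lbrakk>f \<in> Arr C; g \<in> Arr C; Dom C f = Cod C g\<rbrakk> \<Longrightarrow> Dom C (Comp C f g) = Dom C g"
    and cod_comp: "\<lbrakk>f \<in> Arr C; g \<in> Arr C; Dom C f = Cod C g\<rbrakk> \<Longrightarrow> Cod C (Comp C f g) = Cod C f"
    and comp_ide_right: "f \<in> Arr C \<Longrightarrow> Comp C f (Ide C (Dom C f)) = f"
    and comp_ide_left: "f \<in> Arr C \<Longrightarrow> Comp C (Ide C (Cod C f)) f = f"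
    and comp_assoc: "\<lbrakk>f \<in> Arr C; g \<in> Arr C; h \<in> Arr C; Dom C f = Cod C g; Dom C g = Cod C h\<rbrakk>
      \<Longrightarrow> Comp C (Comp C f g) h = Comp C f (Comp C g h)"

record ('o, 'm, 'p, 'n) func =
  OMap :: "'o \<Rightarrow> 'p"
  AMap :: "'m \<Rightarrow> 'n"

locale cat_functor = X: category X + A: category A
  for X :: "('o, 'm) cat" and A :: "('p, 'n) cat" +
  fixes F :: "('o, 'm, 'p, 'n) func"
  assumes map_obj: "x \<in> Obj X \<Longrightarrow> OMap F x \<in> Obj A"
    and map_arr: "f \<in> Arr X \<Longrightarrow> AMap F f \<in> Arr A"
    and map_dom: "f \<in> Arr X \<Longrightarrow> Dom A (AMap F f) = OMap F (Dom X f)"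
    and map_cod: "f \<in> Arr X \<Longrightarrow> Cod A (AMap F f) = OMap F (Cod X f)"
    and map_ide: "x \<in> Obj X \<Longrightarrow> AMap F (Ide X x) = Ide A (OMap F x)"
    and map_comp: "\<lbrakk>f \<in> Arr X; g \<in> Arr X; Dom X f = Cod X g\<rbrakk>
      \<Longrightarrow> AMap F (Comp X f g) = Comp A (AMap F f) (AMap F g)"

definition func_comp ::
    "('p, 'n, 'q, 'k) func \<Rightarrow> ('o, 'm, 'p, 'n) func \<Rightarrow> ('o, 'm, 'q, 'k) func"
    (infixr "\<cdot>\<^sub>F" 70) where
  "G \<cdot>\<^sub>F F = \<lparr>OMap = OMap G \<circ> OMap F, AMap = AMap G \<circ> AMap F\<rparr>"

text \<open>Equality of functors out of \<open>X\<close>, ignoring values outside the carriers of \<open>X\<close>.\<close>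

definition func_eq ::
    "('o, 'm) cat \<Rightarrow> ('o, 'm, 'p, 'n) func \<Rightarrow> ('o, 'm, 'p, 'n) func \<Rightarrow> bool" where
  "func_eq X F G \<longleftrightarrow>
    (\<forall>x\<in>Obj X. OMap F x = OMap G x) \<and> (\<forall>f\<in>Arr X. AMap F f = AMap G f)"

definition prod_cat :: "('o, 'm) cat \<Rightarrow> ('p, 'n) cat \<Rightarrow> ('o \<times> 'p, 'm \<times> 'n) cat"
    (infixr "\<times>\<^sub>C" 75) where
  "A \<times>\<^sub>C B = \<lparr>
    Obj = Obj A \<times> Obj B,
    Arr = Arr A \<times> Arr B,
    Dom = (\<lambda>(f, g). (Dom A f, Dom B g)),
    Cod = (\<lambda>(f, g). (Cod A f, Cod B g)),
    Ide = (\<lambda>(a, b). (Ide A a, Ide B b)),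
    Comp = (\<lambda>(f, g) (f', g'). (Comp A f f', Comp B g g'))\<rparr>"

definition Pr0 :: "('o \<times> 'p, 'm \<times> 'n, 'o, 'm) func" where
  "Pr0 = \<lparr>OMap = fst, AMap = fst\<rparr>"

definition Pr1 :: "('o \<times> 'p, 'm \<times> 'n, 'p, 'n) func" where
  "Pr1 = \<lparr>OMap = snd, AMap = snd\<rparr>"


subsection \<open>Cartesian and opcartesian arrows, fibrations and opfibrations\<close>

text \<open>The equations \<open>F g = F f \<cdot> \<psi>\<close> and \<open>f \<cdot> h = g\<close> carry the side condition that the
  composites are defined.\<close>

definition cartesian ::
    "('o, 'm) cat \<Rightarrow> ('p, 'n) cat \<Rightarrow> ('o, 'm, 'p, 'n) func \<Rightarrow> 'm \<Rightarrow> bool" where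
  "cartesian X A F f \<longleftrightarrow> f \<in> Arr X \<and>
    (\<forall>g\<in>Arr X. \<forall>\<psi>\<in>Arr A.
      Cod X g = Cod X f \<and> Cod A \<psi> = Dom A (AMap F f) \<and> AMap F g = Comp A (AMap F f) \<psi> \<longrightarrow>
      (\<exists>!h. h \<in> Arr X \<and> Cod X h = Dom X f \<and> Comp X f h = g \<and> AMap F h = \<psi>))"

definition opcartesian ::
    "('o, 'm) cat \<Rightarrow> ('p, 'n) cat \<Rightarrow> ('o, 'm, 'p, 'n) func \<Rightarrow> 'm \<Rightarrow> bool" where
  "opcartesian X A F f \<longleftrightarrow> f \<in> Arr X \<and>
    (\<forall>g\<in>Arr X. \<forall>\<psi>\<in>Arr A.
      Dom X g = Dom X f \<and> Dom A \<psi> = Cod A (AMap F f) \<and> AMap F g = Comp A \<psi> (AMap F f) \<longrightarrow>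
      (\<exists>!h. h \<in> Arr X \<and> Dom X h = Cod X f \<and> Comp X h f = g \<and> AMap F h = \<psi>))"

definition cartesian_lifting ::
    "('o, 'm) cat \<Rightarrow> ('p, 'n) cat \<Rightarrow> ('o, 'm, 'p, 'n) func \<Rightarrow> 'n \<Rightarrow> 'o \<Rightarrow> 'm \<Rightarrow> bool" where
  "cartesian_lifting X A F \<phi> x f \<longleftrightarrow> cartesian X A F f \<and> Cod X f = x \<and> AMap F f = \<phi>"

definition opcartesian_lifting ::
    "('o, 'm) cat \<Rightarrow> ('p, 'n) cat \<Rightarrow> ('o, 'm, 'p, 'n) func \<Rightarrow> 'n \<Rightarrow> 'o \<Rightarrow> 'm \<Rightarrow> bool" where
  "opcartesian_lifting X A F \<phi> x f \<longleftrightarrow> opcartesian X A F f \<and> Dom X f = x \<and> AMap F f = \<phi>"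

definition fibration :: "('o, 'm) cat \<Rightarrow> ('p, 'n) cat \<Rightarrow> ('o, 'm, 'p, 'n) func \<Rightarrow> bool" where
  "fibration X A F \<longleftrightarrow> cat_functor X A F \<and>
    (\<forall>x\<in>Obj X. \<forall>\<phi>\<in>Arr A. Cod A \<phi> = OMap F x \<longrightarrow> (\<exists>f. cartesian_lifting X A F \<phi> x f))"

definition opfibration :: "('o, 'm) cat \<Rightarrow> ('p, 'n) cat \<Rightarrow> ('o, 'm, 'p, 'n) func \<Rightarrow> bool" where
  "opfibration X A F \<longleftrightarrow> cat_functor X A F \<and>
    (\<forall>x\<in>Obj X. \<forall>\<phi>\<in>Arr A. Dom A \<phi> = OMap F x \<longrightarrow> (\<exists>f. opcartesian_lifting X A F \<phi> x f))"

text \<open>The standing assumption that (op)fibrations admit a cleavage needs no separate hypothesis,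
  because HOL has a choice operator.\<close>

lemma fibration_admits_cleavage:
  assumes "fibration X A F"
  shows "\<exists>\<kappa>. \<forall>x\<in>Obj X. \<forall>\<phi>\<in>Arr A. Cod A \<phi> = OMap F x \<longrightarrow> cartesian_lifting X A F \<phi> x (\<kappa> \<phi> x)"
  by (rule exI[of _ "\<lambda>\<phi> x. SOME f. cartesian_lifting X A F \<phi> x f"])
    (use assms in \<open>auto simp: fibration_def intro: someI_ex\<close>)

lemma opfibration_admits_cleavage:
  assumes "opfibration X A F"
  shows "\<exists>\<kappa>. \<forall>x\<in>Obj X. \<forall>\<phi>\<in>Arr A. Dom A \<phi> = OMap F x \<longrightarrow> opcartesian_lifting X A F \<phi> x (\<kappa> \<phi> x)"
  by (rule exI[of _ "\<lambda>\<phi> x. SOME f. opcartesian_lifting X A F \<phi> x f"])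
    (use assms in \<open>auto simp: opfibration_def intro: someI_ex\<close>)


subsection \<open>Regular spans\<close>

definition regular_span ::
    "('o, 'm) cat \<Rightarrow> ('p, 'n) cat \<Rightarrow> ('q, 'k) cat \<Rightarrow> ('o, 'm, 'p \<times> 'q, 'n \<times> 'k) func \<Rightarrow> bool" where
  "regular_span X A B S \<longleftrightarrow> cat_functor X (A \<times>\<^sub>C B) S \<and>
    (let S0 = Pr0 \<cdot>\<^sub>F S; S1 = Pr1 \<cdot>\<^sub>F S in
      (\<forall>x'\<in>Obj X. \<forall>\<alpha>\<in>Arr A. Cod A \<alpha> = OMap S0 x' \<longrightarrow>
        (\<exists>\<xi>. cartesian X A S0 \<xi> \<and> Cod X \<xi> = x' \<and>
          AMap S0 \<xi> = \<alpha> \<and> AMap S1 \<xi> = Ide B (OMap S1 x'))) \<and>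
      (\<forall>x\<in>Obj X. \<forall>\<beta>\<in>Arr B. Dom B \<beta> = OMap S1 x \<longrightarrow>
        (\<exists>\<xi>. opcartesian X B S1 \<xi> \<and> Dom X \<xi> = x \<and>
          AMap S1 \<xi> = \<beta> \<and> AMap S0 \<xi> = Ide A (OMap S0 x))))"


subsection \<open>Morphisms of (op)fibrations over a base and their restrictions to fibers\<close>

definition fib_morphism ::
    "('p, 'n) cat \<Rightarrow> ('o, 'm) cat \<Rightarrow> ('o, 'm, 'p, 'n) func \<Rightarrow>
      ('q, 'k) cat \<Rightarrow> ('q, 'k, 'p, 'n) func \<Rightarrow> ('o, 'm, 'q, 'k) func \<Rightarrow> bool" where
  "fib_morphism A X F M G P \<longleftrightarrow>
    fibration X A F \<and> fibration M A G \<and> cat_functor X M P \<and> func_eq X (G \<cdot>\<^sub>F P) F \<and>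
    (\<forall>f. cartesian X A F f \<longrightarrow> cartesian M A G (AMap P f))"

definition opfib_morphism ::
    "('p, 'n) cat \<Rightarrow> ('o, 'm) cat \<Rightarrow> ('o, 'm, 'p, 'n) func \<Rightarrow>
      ('q, 'k) cat \<Rightarrow> ('q, 'k, 'p, 'n) func \<Rightarrow> ('o, 'm, 'q, 'k) func \<Rightarrow> bool" where
  "opfib_morphism A X F M G P \<longleftrightarrow>
    opfibration X A F \<and> opfibration M A G \<and> cat_functor X M P \<and> func_eq X (G \<cdot>\<^sub>F P) F \<and>
    (\<forall>f. opcartesian X A F f \<longrightarrow> opcartesian M A G (AMap P f))"

definition fiber ::
    "('o, 'm) cat \<Rightarrow> ('p, 'n) cat \<Rightarrow> ('o, 'm, 'p, 'n) func \<Rightarrow> 'p \<Rightarrow> ('o, 'm) cat" where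
  "fiber X A F a = X\<lparr>
    Obj := {x \<in> Obj X. OMap F x = a},
    Arr := {f \<in> Arr X. AMap F f = Ide A a}\<rparr>"

text \<open>The restriction of \<open>P\<close> to fibers is given by the same maps \<open>P\<close>, regarded as a functor
  between the fibers.\<close>

definition fiberwise_opfibration ::
    "('p, 'n) cat \<Rightarrow> ('o, 'm) cat \<Rightarrow> ('o, 'm, 'p, 'n) func \<Rightarrow>
      ('q, 'k) cat \<Rightarrow> ('q, 'k, 'p, 'n) func \<Rightarrow> ('o, 'm, 'q, 'k) func \<Rightarrow> bool" where
  "fiberwise_opfibration A X F M G P \<longleftrightarrow>
    (\<forall>a\<in>Obj A. opfibration (fiber X A F a) (fiber M A G a) P)"

definition fiberwise_fibration ::
    "('p, 'n) cat \<Rightarrow> ('o, 'm) cat \<Rightarrow> ('o, 'm, 'p, 'n) func \<Rightarrow>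
      ('q, 'k) cat \<Rightarrow> ('q, 'k, 'p, 'n) func \<Rightarrow> ('o, 'm, 'q, 'k) func \<Rightarrow> bool" where
  "fiberwise_fibration A X F M G P \<longleftrightarrow>
    (\<forall>a\<in>Obj A. fibration (fiber X A F a) (fiber M A G a) P)"


subsection \<open>Basic facts\<close>

lemma category_prod_cat:
  assumes "category A" "category B"
  shows "category (A \<times>\<^sub>C B)"
proof -
  interpret A: category A by fact
  interpret B: category B by fact
  show ?thesis
    by unfold_locales
      (auto simp: prod_cat_def A.dom_obj A.cod_obj A.ide_arr A.dom_ide A.cod_ide A.comp_arr
        A.dom_comp A.cod_comp A.comp_ide_right A.comp_ide_left A.comp_assoc
        B.dom_obj B.cod_obj B.ide_arr B.dom_ide B.cod_ide B.comp_arr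
        B.dom_comp B.cod_comp B.comp_ide_right B.comp_ide_left B.comp_assoc)
qed

lemma cat_functor_Pr0:
  assumes "category A" "category B"
  shows "cat_functor (A \<times>\<^sub>C B) A Pr0"
  using assms category_prod_cat[OF assms]
  by (auto simp: cat_functor_def cat_functor_axioms_def prod_cat_def Pr0_def)

lemma cat_functor_Pr1:
  assumes "category A" "category B"
  shows "cat_functor (A \<times>\<^sub>C B) B Pr1"
  using assms category_prod_cat[OF assms]
  by (auto simp: cat_functor_def cat_functor_axioms_def prod_cat_def Pr1_def)

lemma cat_functor_comp:
  assumes "cat_functor X M F" "cat_functor M A G"
  shows "cat_functor X A (G \<cdot>\<^sub>F F)"
proof -
  interpret F: cat_functor X M F by fact
  interpret G: cat_functor M A G by fact
  show ?thesis
    by unfold_locales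
      (auto simp: func_comp_def F.map_obj F.map_arr F.map_dom F.map_cod F.map_ide F.map_comp
        G.map_obj G.map_arr G.map_dom G.map_cod G.map_ide G.map_comp)
qed

lemma category_fiber:
  assumes "cat_functor X A F" "a \<in> Obj A"
  shows "category (fiber X A F a)"
proof -
  interpret F: cat_functor X A F by fact
  have dom: "OMap F (Dom X f) = a" and cod: "OMap F (Cod X f) = a"
    if "f \<in> Arr X" "AMap F f = Ide A a" for f
    using that F.map_dom[of f] F.map_cod[of f] assms(2) by (auto simp: F.A.dom_ide F.A.cod_ide)
  have "Comp A (Ide A a) (Ide A a) = Ide A a"
    using F.A.comp_ide_left[of "Ide A a"] assms(2) by (simp add: F.A.ide_arr F.A.cod_ide)
  then show ?thesis
    by unfold_locales
      (auto simp: fiber_def dom cod F.X.dom_obj F.X.cod_obj F.X.ide_arr F.X.dom_ide F.X.cod_ide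
        F.X.comp_arr F.X.dom_comp F.X.cod_comp F.X.comp_ide_right F.X.comp_ide_left
        F.X.comp_assoc F.map_ide F.map_comp)
qed

end

theory Submission
  imports Defs
begin

text \<open>Passing to opposite categories and swapping the legs exchanges the two conditions of a
  regular span, and it exchanges fiberwise opfibrations over \<open>A\<close> with fiberwise fibrations over
  \<open>B\<close>. Hence only the equivalence with fiberwise opfibrations needs an argument, provided it is
  proved in a form that is stable under this symmetry. As the opposite of \<open>A \<times>\<^sub>C B\<close> with its
  projections swapped is not literally a \<open>\<times>\<^sub>C\<close>-product, the argument is carried out for any
  category \<open>M\<close> with two projections that are jointly bijective on arrows
  (locale \<open>category_product\<close>).

  For such an \<open>M\<close>, being a fiberwise opfibration is a property of the legs \<open>S0\<close> and \<open>S1\<close> alone.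
  An arrow of \<open>M\<close> is cartesian over \<open>A\<close> iff its second component is invertible
  (\<open>cartesian_iff\<close>), so \<open>S\<close> preserves cartesian arrows iff \<open>S1\<close> inverts the \<open>S0\<close>-cartesian ones;
  and the fiber of \<open>M\<close> over an object of \<open>A\<close> is a copy of \<open>B\<close> (\<open>opfibration_fiber_iff\<close>), so \<open>S\<close>
  restricts to opfibrations between fibers iff \<open>S1\<close> restricts to an opfibration on every
  \<open>S0\<close>-fiber.

  If the span is regular, an \<open>S0\<close>-cartesian arrow differs by an isomorphism from a cartesian lifting
  that \<open>S1\<close> sends to an identity, so \<open>S1\<close> inverts it; and an \<open>S0\<close>-vertical \<open>S1\<close>-opcartesian arrow
  stays opcartesian in its fiber, because the induced factorizations are vertical again.
  Conversely, an \<open>S0\<close>-cartesian lifting \<open>f\<close> can be corrected: as \<open>S1 f\<close> is invertible, its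
  opcartesian lifting in the fiber is invertible, and composing \<open>f\<close> with the inverse gives a
  lifting that is \<open>S1\<close>-vertical (\<open>vertical_cartesian_liftingsI\<close>). These corrected liftings then
  split any arrow \<open>g\<close> of \<open>X\<close> as a cartesian arrow after an \<open>S0\<close>-vertical one without changing
  \<open>S1 g\<close>, which reduces the universal property in \<open>X\<close> of an arrow opcartesian in a fiber to the one
  that it has in the fiber (\<open>opcartesian_if_opcartesian_in_fiber\<close>).\<close>

section \<open>Isomorphisms and opposite categories\<close>

lemmas (in category) [simp] = dom_obj cod_obj ide_arr dom_ide cod_ide comp_arr dom_comp cod_comp
  comp_ide_left comp_ide_right

lemmas (in cat_functor) [simp] = map_obj map_arr map_dom map_cod map_ide map_comp

lemma (in category) comp_ide_leftI [simp]:
  "\<lbrakk>f \<in> Arr C; Cod C f = a\<rbrakk> \<Longrightarrow> Comp C (Ide C a) f = f"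
  using comp_ide_left by blast

lemma (in category) comp_ide_rightI [simp]:
  "\<lbrakk>f \<in> Arr C; Dom C f = a\<rbrakk> \<Longrightarrow> Comp C f (Ide C a) = f"
  using comp_ide_right by blast

definition inverse_arrows :: "('o, 'm) cat \<Rightarrow> 'm \<Rightarrow> 'm \<Rightarrow> bool" where
  "inverse_arrows C f g \<longleftrightarrow> f \<in> Arr C \<and> g \<in> Arr C \<and> Dom C f = Cod C g \<and> Cod C f = Dom C g \<and>
    Comp C f g = Ide C (Dom C g) \<and> Comp C g f = Ide C (Dom C f)"

definition is_iso :: "('o, 'm) cat \<Rightarrow> 'm \<Rightarrow> bool" where
  "is_iso C f \<longleftrightarrow> (\<exists>g. inverse_arrows C f g)"

lemma (in category) is_iso_ide: "a \<in> Obj C \<Longrightarrow> is_iso C (Ide C a)"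
  unfolding is_iso_def by (rule exI[of _ "Ide C a"]) (simp add: inverse_arrows_def)

lemma (in cat_functor) obj_inj_if_arr_inj:
  assumes "inj_on (AMap F) (Arr X)" "x \<in> Obj X" "y \<in> Obj X"
  shows "OMap F x = OMap F y \<longleftrightarrow> x = y"
proof
  assume "OMap F x = OMap F y"
  then have "Ide X x = Ide X y"
    using assms by (auto intro: inj_onD)
  then show "x = y" using assms X.dom_ide by metis
qed simp

lemma (in cat_functor) map_inverse_arrows:
  assumes "inverse_arrows X f g"
  shows "inverse_arrows A (AMap F f) (AMap F g)"
proof -
  have *: "f \<in> Arr X" "g \<in> Arr X" "Dom X f = Cod X g" "Cod X f = Dom X g"
    "Comp X f g = Ide X (Dom X g)" "Comp X g f = Ide X (Dom X f)"
    using assms by (auto simp: inverse_arrows_def)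
  have "Comp A (AMap F f) (AMap F g) = Ide A (OMap F (Dom X g))"
    using map_comp[of f g] * map_ide X.dom_obj by simp
  moreover have "Comp A (AMap F g) (AMap F f) = Ide A (OMap F (Dom X f))"
    using map_comp[of g f] * map_ide X.dom_obj by metis
  ultimately show ?thesis
    using * by (simp add: inverse_arrows_def map_arr map_dom map_cod)
qed

definition op_cat :: "('o, 'm) cat \<Rightarrow> ('o, 'm) cat" where
  "op_cat C = \<lparr>Obj = Obj C, Arr = Arr C, Dom = Cod C, Cod = Dom C, Ide = Ide C,
    Comp = (\<lambda>f g. Comp C g f)\<rparr>"

lemma op_cat_simps [simp]:
  "Obj (op_cat C) = Obj C" "Arr (op_cat C) = Arr C"
  "Dom (op_cat C) = Cod C" "Cod (op_cat C) = Dom C"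
  "Ide (op_cat C) = Ide C" "Comp (op_cat C) f g = Comp C g f"
  by (auto simp: op_cat_def)

lemma op_op_cat [simp]: "op_cat (op_cat C) = C"
  by (simp add: op_cat_def)

lemma category_op_cat: "category C \<Longrightarrow> category (op_cat C)"
  by (simp add: category_def)

lemma cat_functor_op_cat: "cat_functor X A F \<Longrightarrow> cat_functor (op_cat X) (op_cat A) F"
  by (auto simp: cat_functor_def cat_functor_axioms_def category_op_cat)

lemma cat_functor_op_cat_iff [simp]:
  "cat_functor (op_cat X) (op_cat A) F \<longleftrightarrow> cat_functor X A F"
  using cat_functor_op_cat cat_functor_op_cat[of "op_cat X" "op_cat A" F] by auto

lemma inverse_arrows_op_cat [simp]: "inverse_arrows (op_cat C) f g \<longleftrightarrow> inverse_arrows C f g"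
  by (auto simp: inverse_arrows_def)

lemma cartesian_op_cat [simp]: "cartesian (op_cat X) (op_cat A) F f \<longleftrightarrow> opcartesian X A F f"
  by (simp add: cartesian_def opcartesian_def)

lemma opcartesian_op_cat [simp]: "opcartesian (op_cat X) (op_cat A) F f \<longleftrightarrow> cartesian X A F f"
  by (simp add: cartesian_def opcartesian_def)

lemma fibration_op_cat [simp]: "fibration (op_cat X) (op_cat A) F \<longleftrightarrow> opfibration X A F"
  by (simp add: fibration_def opfibration_def cartesian_lifting_def opcartesian_lifting_def)

lemma opfibration_op_cat [simp]: "opfibration (op_cat X) (op_cat A) F \<longleftrightarrow> fibration X A F"
  by (simp add: fibration_def opfibration_def cartesian_lifting_def opcartesian_lifting_def)

lemma fiber_op_cat [simp]: "fiber (op_cat X) (op_cat A) F a = op_cat (fiber X A F a)"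
  by (simp add: fiber_def op_cat_def)

lemma func_eq_op_cat [simp]: "func_eq (op_cat X) F G \<longleftrightarrow> func_eq X F G"
  by (simp add: func_eq_def)

lemma fib_morphism_op_cat [simp]:
  "fib_morphism (op_cat A) (op_cat X) F (op_cat M) G P \<longleftrightarrow> opfib_morphism A X F M G P"
  by (simp add: fib_morphism_def opfib_morphism_def)

lemma fiberwise_opfibration_op_cat [simp]:
  "fiberwise_opfibration (op_cat A) (op_cat X) F (op_cat M) G P \<longleftrightarrow>
    fiberwise_fibration A X F M G P"
  by (simp add: fiberwise_opfibration_def fiberwise_fibration_def)

section \<open>Cartesian arrows\<close>

lemma func_comp_simps [simp]:
  "OMap (G \<cdot>\<^sub>F F) x = OMap G (OMap F x)" "AMap (G \<cdot>\<^sub>F F) f = AMap G (AMap F f)"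
  by (simp_all add: func_comp_def)

lemma cartesian_arr: "cartesian X A F f \<Longrightarrow> f \<in> Arr X"
  by (simp add: cartesian_def)

lemma opcartesian_arr: "opcartesian X A F f \<Longrightarrow> f \<in> Arr X"
  by (simp add: opcartesian_def)

lemma opfibration_lifting:
  assumes "opfibration X A F" "x \<in> Obj X" "\<phi> \<in> Arr A" "Dom A \<phi> = OMap F x"
  shows "\<exists>f. opcartesian_lifting X A F \<phi> x f"
  using assms by (simp add: opfibration_def)

context cat_functor
begin

lemma cartesian_factor:
  assumes "cartesian X A F f" "g \<in> Arr X" "Cod X g = Cod X f"
    and "\<psi> \<in> Arr A" "Cod A \<psi> = OMap F (Dom X f)" "AMap F g = Comp A (AMap F f) \<psi>"
  obtains h where "h \<in> Arr X" "Dom X h = Dom X g" "Cod X h = Dom X f" "Comp X f h = g"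
    "AMap F h = \<psi>"
proof -
  have f: "f \<in> Arr X" using assms(1) by (rule cartesian_arr)
  obtain h where h: "h \<in> Arr X" "Cod X h = Dom X f" "Comp X f h = g" "AMap F h = \<psi>"
    using assms f map_dom[of f] unfolding cartesian_def by metis
  moreover have "Dom X h = Dom X g" using h f X.dom_comp[of f h] by simp
  ultimately show thesis using that by blast
qed

lemma cartesian_cancel:
  assumes "cartesian X A F f" "h \<in> Arr X" "h' \<in> Arr X"
    and "Cod X h = Dom X f" "Cod X h' = Dom X f" "Comp X f h = Comp X f h'"
    and "AMap F h = AMap F h'"
  shows "h = h'"
proof -
  have f: "f \<in> Arr X" using assms(1) by (rule cartesian_arr)
  let ?g = "Comp X f h"
  have "?g \<in> Arr X" "AMap F h \<in> Arr A" "Cod X ?g = Cod X f"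
    "Cod A (AMap F h) = Dom A (AMap F f)" "AMap F ?g = Comp A (AMap F f) (AMap F h)"
    using f assms by (auto simp: X.comp_arr X.cod_comp map_arr map_cod map_dom map_comp)
  then have "\<exists>!k. k \<in> Arr X \<and> Cod X k = Dom X f \<and> Comp X f k = ?g \<and> AMap F k = AMap F h"
    using assms(1) unfolding cartesian_def by blast
  then show ?thesis using assms by metis
qed

lemma cartesianI:
  assumes "f \<in> Arr X"
    and ex: "\<And>g \<psi>. \<lbrakk>g \<in> Arr X; \<psi> \<in> Arr A; Cod X g = Cod X f; Cod A \<psi> = OMap F (Dom X f);
      AMap F g = Comp A (AMap F f) \<psi>\<rbrakk> \<Longrightarrow>
      \<exists>h. h \<in> Arr X \<and> Cod X h = Dom X f \<and> Comp X f h = g \<and> AMap F h = \<psi>"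
    and un: "\<And>h h'. \<lbrakk>h \<in> Arr X; h' \<in> Arr X; Cod X h = Dom X f; Cod X h' = Dom X f;
      Comp X f h = Comp X f h'; AMap F h = AMap F h'\<rbrakk> \<Longrightarrow> h = h'"
  shows "cartesian X A F f"
  unfolding cartesian_def
proof (intro conjI ballI impI)
  show "f \<in> Arr X" by fact
  fix g \<psi> assume "g \<in> Arr X" "\<psi> \<in> Arr A"
    and "Cod X g = Cod X f \<and> Cod A \<psi> = Dom A (AMap F f) \<and> AMap F g = Comp A (AMap F f) \<psi>"
  then have "\<exists>h. h \<in> Arr X \<and> Cod X h = Dom X f \<and> Comp X f h = g \<and> AMap F h = \<psi>"
    using ex map_dom assms(1) by simp
  then show "\<exists>!h. h \<in> Arr X \<and> Cod X h = Dom X f \<and> Comp X f h = g \<and> AMap F h = \<psi>"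
    using un by (metis (no_types, lifting))
qed

text \<open>Both composites of two comparison arrows are fixed by the universal property to be
  identities.\<close>

lemma cartesian_unique_up_to_iso:
  assumes f: "cartesian X A F f" and g: "cartesian X A F g"
    and "Cod X f = Cod X g" "AMap F f = AMap F g"
  obtains i where "is_iso X i" "Dom X i = Dom X f" "Cod X i = Dom X g" "Comp X g i = f"
proof -
  have arr: "f \<in> Arr X" "g \<in> Arr X" using f g by (auto dest: cartesian_arr)
  have obj: "OMap F (Dom X f) = OMap F (Dom X g)"
    using arr assms(4) map_dom by metis
  let ?a = "OMap F (Dom X g)"
  have a: "?a \<in> Obj A" using arr by simp
  have ide: "Comp A (AMap F g) (Ide A ?a) = AMap F g"
    using arr by simp
  obtain i where i: "i \<in> Arr X" "Dom X i = Dom X f" "Cod X i = Dom X g" "Comp X g i = f"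
      "AMap F i = Ide A ?a"
    using cartesian_factor[OF g arr(1), of "Ide A ?a"] assms a ide by auto
  obtain j where j: "j \<in> Arr X" "Dom X j = Dom X g" "Cod X j = Dom X f" "Comp X f j = g"
      "AMap F j = Ide A ?a"
    using cartesian_factor[OF f arr(2), of "Ide A ?a"] assms a ide obj by auto
  have aa: "Comp A (Ide A ?a) (Ide A ?a) = Ide A ?a"
    using a by simp
  have "Comp X g (Comp X i j) = g"
    using i j arr X.comp_assoc[of g i j] by simp
  then have ij: "Comp X i j = Ide X (Dom X g)"
    by - (rule cartesian_cancel[OF g], use i j arr aa in auto)
  have "Comp X f (Comp X j i) = f"
    using i j arr X.comp_assoc[of f j i] by simp
  then have ji: "Comp X j i = Ide X (Dom X f)"
    by - (rule cartesian_cancel[OF f], use i j arr aa obj in auto)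
  have "is_iso X i"
    unfolding is_iso_def inverse_arrows_def using i j ij ji by auto
  then show thesis using that i by blast
qed

text \<open>The inverse is the factorization of an identity; it is two-sided because factorizations are
  unique.\<close>

lemma inverse_arrows_if_cartesian_over_iso:
  assumes f: "cartesian X A F f" and \<tau>: "inverse_arrows A (AMap F f) \<tau>"
  obtains g where "inverse_arrows X f g" "AMap F g = \<tau>"
proof -
  have arr: "f \<in> Arr X" using f by (rule cartesian_arr)
  have t: "\<tau> \<in> Arr A" "Cod A \<tau> = OMap F (Dom X f)" "Dom A \<tau> = OMap F (Cod X f)"
    "Comp A (AMap F f) \<tau> = Ide A (Dom A \<tau>)" "Comp A \<tau> (AMap F f) = Ide A (OMap F (Dom X f))"
    using \<tau> arr by (auto simp: inverse_arrows_def)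
  obtain g where g: "g \<in> Arr X" "Dom X g = Cod X f" "Cod X g = Dom X f"
      "Comp X f g = Ide X (Cod X f)" "AMap F g = \<tau>"
    using cartesian_factor[OF f, of "Ide X (Cod X f)" \<tau>] arr t by auto
  have "Comp X f (Comp X g f) = f"
    using g arr X.comp_assoc[of f g f] by simp
  then have "Comp X g f = Ide X (Dom X f)"
    by - (rule cartesian_cancel[OF f], use g arr t in auto)
  then have "inverse_arrows X f g"
    using g arr by (auto simp: inverse_arrows_def)
  then show thesis using that g by blast
qed

lemma cartesian_comp_iso:
  assumes f: "cartesian X A F f" and i: "inverse_arrows X i j" and "Cod X i = Dom X f"
  shows "cartesian X A F (Comp X f i)"
proof (rule cartesianI)
  have arr: "f \<in> Arr X" "i \<in> Arr X" "j \<in> Arr X" using f i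
    by (auto dest: cartesian_arr simp: inverse_arrows_def)
  have ij: "Dom X j = Dom X f" "Cod X j = Dom X i" "Comp X i j = Ide X (Dom X f)"
    "Comp X j i = Ide X (Dom X i)"
    using i assms(3) by (auto simp: inverse_arrows_def)
  show "Comp X f i \<in> Arr X" using arr assms by simp
  fix g \<psi> assume g: "g \<in> Arr X" "\<psi> \<in> Arr A" "Cod X g = Cod X (Comp X f i)"
      "Cod A \<psi> = OMap F (Dom X (Comp X f i))" "AMap F g = Comp A (AMap F (Comp X f i)) \<psi>"
  have "AMap F g = Comp A (AMap F f) (Comp A (AMap F i) \<psi>)"
    using g arr assms(3) A.comp_assoc[of "AMap F f" "AMap F i" \<psi>] by simp
  then obtain k where k: "k \<in> Arr X" "Cod X k = Dom X f" "Comp X f k = g"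
      "AMap F k = Comp A (AMap F i) \<psi>"
    using cartesian_factor[OF f g(1), of "Comp A (AMap F i) \<psi>"] g arr assms(3) by auto
  let ?h = "Comp X j k"
  have "Comp X i ?h = k"
    using X.comp_assoc[of i j k] arr k ij by simp
  moreover have "Comp X (Comp X f i) ?h = Comp X f (Comp X i ?h)"
    by (rule X.comp_assoc) (use arr k ij assms(3) in simp_all)
  ultimately have "Comp X (Comp X f i) ?h = g" using k by simp
  moreover have "Comp A (AMap F j) (AMap F i) = Ide A (OMap F (Dom X i))"
    using map_comp[of j i] arr ij assms(3) by simp
  then have "AMap F ?h = \<psi>"
    using A.comp_assoc[of "AMap F j" "AMap F i" \<psi>] arr k ij assms(3) g by simp
  ultimately show "\<exists>h. h \<in> Arr X \<and> Cod X h = Dom X (Comp X f i) \<and> Comp X (Comp X f i) h = g \<and>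
      AMap F h = \<psi>"
    using arr k ij assms(3) by (intro exI[of _ ?h]) simp
next
  have arr: "f \<in> Arr X" "i \<in> Arr X" "j \<in> Arr X" using f i
    by (auto dest: cartesian_arr simp: inverse_arrows_def)
  have ij: "Dom X j = Dom X f" "Cod X j = Dom X i" "Comp X i j = Ide X (Dom X f)"
    "Comp X j i = Ide X (Dom X i)"
    using i assms(3) by (auto simp: inverse_arrows_def)
  fix h h' assume h: "h \<in> Arr X" "h' \<in> Arr X" "Cod X h = Dom X (Comp X f i)"
    "Cod X h' = Dom X (Comp X f i)" "Comp X (Comp X f i) h = Comp X (Comp X f i) h'"
    "AMap F h = AMap F h'"
  have "Comp X i h = Comp X i h'"
    by (rule cartesian_cancel[OF f])
      (use h arr assms(3) X.comp_assoc[of f i h] X.comp_assoc[of f i h'] in auto)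
  then show "h = h'"
    using X.comp_assoc[of j i h] X.comp_assoc[of j i h'] h arr ij assms(3) by simp
qed

end

section \<open>Categories with jointly bijective projections\<close>

text \<open>Bijectivity on arrows is enough to recover the objects, via identities.\<close>

locale category_product = P: cat_functor M A P + Q: cat_functor M B Q
  for M :: "('r, 'l) cat" and A :: "('p, 'n) cat" and B :: "('q, 'k) cat" and P Q +
  assumes arr_bij: "bij_betw (\<lambda>m. (AMap P m, AMap Q m)) (Arr M) (Arr A \<times> Arr B)"
begin

lemma arr_eqI: "\<lbrakk>m \<in> Arr M; m' \<in> Arr M; AMap P m = AMap P m'; AMap Q m = AMap Q m'\<rbrakk> \<Longrightarrow> m = m'"
  using arr_bij by (auto simp: bij_betw_def inj_on_def)

lemma obj_eqI:
  assumes "x \<in> Obj M" "y \<in> Obj M" "OMap P x = OMap P y" "OMap Q x = OMap Q y"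
  shows "x = y"
proof -
  have "Ide M x = Ide M y" by (rule arr_eqI) (use assms in auto)
  then show ?thesis using assms P.X.dom_ide by metis
qed

lemma pair_arr:
  assumes "f \<in> Arr A" "g \<in> Arr B"
  obtains m where "m \<in> Arr M" "AMap P m = f" "AMap Q m = g"
proof -
  have "(f, g) \<in> (\<lambda>m. (AMap P m, AMap Q m)) ` Arr M"
    using arr_bij assms by (auto simp: bij_betw_def)
  then show thesis using that by auto
qed

text \<open>The first component of a factorization is prescribed, and the second one is forced by the
  inverse.\<close>

lemma cartesian_if_iso:
  assumes f: "f \<in> Arr M" and iso: "is_iso B (AMap Q f)"
  shows "cartesian M A P f"
proof (rule P.cartesianI)
  obtain \<tau> where "inverse_arrows B (AMap Q f) \<tau>" using iso by (auto simp: is_iso_def)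
  then have t: "\<tau> \<in> Arr B" "Cod B \<tau> = OMap Q (Dom M f)" "Dom B \<tau> = OMap Q (Cod M f)"
    "Comp B (AMap Q f) \<tau> = Ide B (OMap Q (Cod M f))"
    "Comp B \<tau> (AMap Q f) = Ide B (OMap Q (Dom M f))"
    using f by (auto simp: inverse_arrows_def)
  show "f \<in> Arr M" by fact
  fix g \<psi> assume g: "g \<in> Arr M" "\<psi> \<in> Arr A" "Cod M g = Cod M f" "Cod A \<psi> = OMap P (Dom M f)"
    "AMap P g = Comp A (AMap P f) \<psi>"
  obtain h where h: "h \<in> Arr M" "AMap P h = \<psi>" "AMap Q h = Comp B \<tau> (AMap Q g)"
    using pair_arr[of \<psi> "Comp B \<tau> (AMap Q g)"] g t by auto
  have cod: "Cod M h = Dom M f"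
    by (rule obj_eqI) (use h g t f P.map_cod[of h] Q.map_cod[of h] in auto)
  have "Comp B (AMap Q f) (Comp B \<tau> (AMap Q g)) = AMap Q g"
    using Q.A.comp_assoc[of "AMap Q f" \<tau> "AMap Q g"] f g t by simp
  then have "Comp M f h = g"
    by (intro arr_eqI) (use h g f cod in auto)
  then show "\<exists>h. h \<in> Arr M \<and> Cod M h = Dom M f \<and> Comp M f h = g \<and> AMap P h = \<psi>"
    using h cod by blast
next
  obtain \<tau> where "inverse_arrows B (AMap Q f) \<tau>" using iso by (auto simp: is_iso_def)
  then have t: "\<tau> \<in> Arr B" "Dom B \<tau> = OMap Q (Cod M f)"
    "Comp B \<tau> (AMap Q f) = Ide B (OMap Q (Dom M f))"
    using f by (auto simp: inverse_arrows_def)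
  have cancel: "AMap Q k = Comp B \<tau> (AMap Q (Comp M f k))"
    if "k \<in> Arr M" "Cod M k = Dom M f" for k
    using Q.A.comp_assoc[of \<tau> "AMap Q f" "AMap Q k"] f t that by simp
  fix h h' assume h: "h \<in> Arr M" "h' \<in> Arr M" "Cod M h = Dom M f" "Cod M h' = Dom M f"
    "Comp M f h = Comp M f h'" "AMap P h = AMap P h'"
  have "AMap Q h = AMap Q h'" using h cancel by metis
  then show "h = h'" using h arr_eqI by blast
qed

text \<open>For the converse, a right inverse of the second component comes from factoring the arrow
  with the same first component and an identity as the second one; uniqueness makes it two-sided.\<close>

lemma cartesian_iff: "cartesian M A P f \<longleftrightarrow> f \<in> Arr M \<and> is_iso B (AMap Q f)"
proof
  assume c: "cartesian M A P f"
  then have f: "f \<in> Arr M" by (rule cartesian_arr)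
  let ?a = "OMap P (Dom M f)" and ?b = "OMap Q (Cod M f)" and ?\<beta> = "AMap Q f"
  obtain g where g: "g \<in> Arr M" "AMap P g = AMap P f" "AMap Q g = Ide B ?b"
    using pair_arr[of "AMap P f" "Ide B ?b"] f by auto
  have cod: "Cod M g = Cod M f"
    by (rule obj_eqI) (use f g P.map_cod[of g] Q.map_cod[of g] in auto)
  obtain h where h: "h \<in> Arr M" "Dom M h = Dom M g" "Cod M h = Dom M f" "Comp M f h = g"
      "AMap P h = Ide A ?a"
    using P.cartesian_factor[OF c g(1) cod, of "Ide A ?a"] f g by auto
  let ?\<tau> = "AMap Q h"
  have dom_\<tau>: "Dom B ?\<tau> = ?b" using h g f Q.map_dom[of g] by auto
  have right: "Comp B ?\<beta> ?\<tau> = Ide B ?b" using h g f Q.map_comp[of f h] by simp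
  obtain k where k: "k \<in> Arr M" "AMap P k = Ide A ?a" "AMap Q k = Comp B ?\<tau> ?\<beta>"
    using pair_arr[of "Ide A ?a" "Comp B ?\<tau> ?\<beta>"] f h dom_\<tau> by auto
  have cod_k: "Cod M k = Dom M f"
    by (rule obj_eqI) (use f h k dom_\<tau> P.map_cod[of k] Q.map_cod[of k] in auto)
  have "Comp B ?\<beta> (Comp B ?\<tau> ?\<beta>) = ?\<beta>"
    using Q.A.comp_assoc[of ?\<beta> ?\<tau> ?\<beta>] f h right dom_\<tau> by simp
  then have "Comp M f k = f"
    by (intro arr_eqI) (use f k cod_k in auto)
  then have "k = Ide M (Dom M f)"
    by - (rule P.cartesian_cancel[OF c], use f k cod_k in auto)
  then have "Comp B ?\<tau> ?\<beta> = Ide B (OMap Q (Dom M f))" using k f by auto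
  then have "inverse_arrows B ?\<beta> ?\<tau>"
    using right dom_\<tau> f h by (simp add: inverse_arrows_def)
  then show "f \<in> Arr M \<and> is_iso B (AMap Q f)" using f by (auto simp: is_iso_def)
qed (simp add: cartesian_if_iso)

lemma fibration_proj: "fibration M A P"
  unfolding fibration_def
proof (intro conjI ballI impI)
  show "cat_functor M A P" by unfold_locales
  fix x \<phi> assume x: "x \<in> Obj M" "\<phi> \<in> Arr A" "Cod A \<phi> = OMap P x"
  obtain f where f: "f \<in> Arr M" "AMap P f = \<phi>" "AMap Q f = Ide B (OMap Q x)"
    using pair_arr[of \<phi> "Ide B (OMap Q x)"] x by auto
  have "Cod M f = x"
    by (rule obj_eqI) (use f x P.map_cod[of f] Q.map_cod[of f] in auto)
  then show "\<exists>f. cartesian_lifting M A P \<phi> x f"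
    using f x Q.A.is_iso_ide by (auto simp: cartesian_lifting_def cartesian_iff)
qed

lemma op_category_product: "category_product (op_cat M) (op_cat B) (op_cat A) Q P"
proof -
  have "bij_betw prod.swap (Arr A \<times> Arr B) (Arr B \<times> Arr A)"
    by (auto simp: bij_betw_def product_swap)
  from bij_betw_trans[OF arr_bij this] show ?thesis
    by (simp add: category_product_def category_product_axioms_def P.cat_functor_axioms
        Q.cat_functor_axioms comp_def)
qed

end

lemma category_product_prod_cat:
  assumes "category A" "category B"
  shows "category_product (A \<times>\<^sub>C B) A B Pr0 Pr1"
  using cat_functor_Pr0[OF assms] cat_functor_Pr1[OF assms]
  by (simp add: category_product_def category_product_axioms_def prod_cat_def Pr0_def Pr1_def
      bij_betw_def)

section \<open>Functors out of a fiber\<close>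

lemma fiber_simps [simp]:
  "x \<in> Obj (fiber X A F a) \<longleftrightarrow> x \<in> Obj X \<and> OMap F x = a"
  "f \<in> Arr (fiber X A F a) \<longleftrightarrow> f \<in> Arr X \<and> AMap F f = Ide A a"
  "Dom (fiber X A F a) = Dom X" "Cod (fiber X A F a) = Cod X"
  "Ide (fiber X A F a) = Ide X" "Comp (fiber X A F a) = Comp X"
  by (auto simp: fiber_def)

lemma cat_functor_fiber:
  assumes "cat_functor X A F" "cat_functor X B G" "a \<in> Obj A"
  shows "cat_functor (fiber X A F a) B G"
  using assms category_fiber[OF assms(1,3)]
  by (auto simp: cat_functor_def cat_functor_axioms_def)

text \<open>Being opcartesian does not change when the codomain of the functor is replaced along an
  isomorphism of categories.\<close>

lemma opcartesian_func_comp_iso: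
  assumes F: "cat_functor Y N F" and G: "cat_functor N B G"
    and bij: "bij_betw (AMap G) (Arr N) (Arr B)"
  shows "opcartesian Y B (G \<cdot>\<^sub>F F) f \<longleftrightarrow> opcartesian Y N F f"
proof -
  interpret F: cat_functor Y N F by fact
  interpret G: cat_functor N B G by fact
  note inj_on = bij_betw_imp_inj_on[OF bij]
  note inj = inj_on_eq_iff[OF inj_on] and obj_inj = G.obj_inj_if_arr_inj[OF inj_on]
  have arr_B: "Arr B = AMap G ` Arr N"
    using bij by (simp add: bij_betw_def)
  have eq: "Dom N \<psi> = OMap F (Cod Y f) \<Longrightarrow> AMap G (AMap F g) = Comp B (AMap G \<psi>) (AMap G (AMap F f)) \<longleftrightarrow>
      AMap F g = Comp N \<psi> (AMap F f)" if "f \<in> Arr Y" "g \<in> Arr Y" "\<psi> \<in> Arr N" for g \<psi>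
    using that inj[of "AMap F g" "Comp N \<psi> (AMap F f)"] by simp
  show ?thesis
    unfolding opcartesian_def arr_B
    by (auto simp: obj_inj inj eq cong: conj_cong)
qed

lemma opfibration_func_comp_iso:
  assumes F: "cat_functor Y N F" and G: "cat_functor N B G"
    and bij: "bij_betw (AMap G) (Arr N) (Arr B)"
  shows "opfibration Y B (G \<cdot>\<^sub>F F) \<longleftrightarrow> opfibration Y N F"
proof -
  interpret F: cat_functor Y N F by fact
  interpret G: cat_functor N B G by fact
  note inj_on = bij_betw_imp_inj_on[OF bij]
  note inj = inj_on_eq_iff[OF inj_on] and obj_inj = G.obj_inj_if_arr_inj[OF inj_on]
  have arr_B: "Arr B = AMap G ` Arr N"
    using bij by (simp add: bij_betw_def)
  have "opcartesian_lifting Y B (G \<cdot>\<^sub>F F) (AMap G \<phi>) x = opcartesian_lifting Y N F \<phi> x"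
    if "\<phi> \<in> Arr N" for \<phi> x
    using that
    by (auto simp: fun_eq_iff opcartesian_lifting_def opcartesian_func_comp_iso[OF assms] inj
        dest: opcartesian_arr)
  then show ?thesis
    using F cat_functor_comp[OF F G]
    by (auto simp: opfibration_def arr_B obj_inj)
qed

text \<open>The fiber of \<open>M\<close> over an object of \<open>A\<close> is isomorphic to \<open>B\<close> through the second
  projection.\<close>

lemma (in category_product) opfibration_fiber_iff:
  assumes S: "cat_functor X M S" and a: "a \<in> Obj A"
  shows "opfibration (fiber X A (P \<cdot>\<^sub>F S) a) (fiber M A P a) S \<longleftrightarrow>
    opfibration (fiber X A (P \<cdot>\<^sub>F S) a) B (Q \<cdot>\<^sub>F S)"
proof (rule opfibration_func_comp_iso[symmetric])
  interpret S: cat_functor X M S by fact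
  have PS: "cat_functor X A (P \<cdot>\<^sub>F S)"
    by (rule cat_functor_comp[OF S P.cat_functor_axioms])
  show "cat_functor (fiber X A (P \<cdot>\<^sub>F S) a) (fiber M A P a) S"
    using category_fiber[OF PS a] category_fiber[OF P.cat_functor_axioms a]
    by (auto simp: cat_functor_def cat_functor_axioms_def)
  show "cat_functor (fiber M A P a) B Q"
    by (rule cat_functor_fiber[OF P.cat_functor_axioms Q.cat_functor_axioms a])
  show "bij_betw (AMap Q) (Arr (fiber M A P a)) (Arr B)"
    unfolding bij_betw_def
  proof (intro conjI inj_onI equalityI subsetI)
    fix \<beta> assume "\<beta> \<in> Arr B"
    then obtain m where "m \<in> Arr M" "AMap P m = Ide A a" "AMap Q m = \<beta>"
      using pair_arr[of "Ide A a" \<beta>] a by auto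
    then show "\<beta> \<in> AMap Q ` Arr (fiber M A P a)" by auto
  qed (auto intro: arr_eqI)
qed

section \<open>Spans given by their legs\<close>

text \<open>The two halves of regularity are stated for arbitrary functors \<open>F\<close> and \<open>G\<close> out of \<open>X\<close>, so
  that each is literally the dual of the other.\<close>

definition vertical_cartesian_liftings ::
    "('o, 'm) cat \<Rightarrow> ('p, 'n) cat \<Rightarrow> ('o, 'm, 'p, 'n) func \<Rightarrow>
      ('q, 'k) cat \<Rightarrow> ('o, 'm, 'q, 'k) func \<Rightarrow> bool" where
  "vertical_cartesian_liftings X A F B G \<longleftrightarrow>
    (\<forall>x\<in>Obj X. \<forall>\<phi>\<in>Arr A. Cod A \<phi> = OMap F x \<longrightarrow>
      (\<exists>f. cartesian_lifting X A F \<phi> x f \<and> AMap G f = Ide B (OMap G x)))"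

definition vertical_opcartesian_liftings ::
    "('o, 'm) cat \<Rightarrow> ('p, 'n) cat \<Rightarrow> ('o, 'm, 'p, 'n) func \<Rightarrow>
      ('q, 'k) cat \<Rightarrow> ('o, 'm, 'q, 'k) func \<Rightarrow> bool" where
  "vertical_opcartesian_liftings X A F B G \<longleftrightarrow>
    (\<forall>x\<in>Obj X. \<forall>\<phi>\<in>Arr A. Dom A \<phi> = OMap F x \<longrightarrow>
      (\<exists>f. opcartesian_lifting X A F \<phi> x f \<and> AMap G f = Ide B (OMap G x)))"

lemma vertical_liftings_op_cat [simp]:
  "vertical_cartesian_liftings (op_cat X) (op_cat A) F (op_cat B) G \<longleftrightarrow>
    vertical_opcartesian_liftings X A F B G"
  "vertical_opcartesian_liftings (op_cat X) (op_cat A) F (op_cat B) G \<longleftrightarrow>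
    vertical_cartesian_liftings X A F B G"
  by (simp_all add: vertical_cartesian_liftings_def vertical_opcartesian_liftings_def
      cartesian_lifting_def opcartesian_lifting_def)

locale span = S0: cat_functor X A S0 + S1: cat_functor X B S1
  for X :: "('o, 'm) cat" and A :: "('p, 'n) cat" and B :: "('q, 'k) cat" and S0 S1
begin

lemma iso_if_cartesian:
  assumes R0: "vertical_cartesian_liftings X A S0 B S1" and f: "cartesian X A S0 f"
  shows "is_iso B (AMap S1 f)"
proof -
  have arr: "f \<in> Arr X" using f by (rule cartesian_arr)
  obtain \<xi> where \<xi>: "cartesian X A S0 \<xi>" "Cod X \<xi> = Cod X f" "AMap S0 \<xi> = AMap S0 f"
      "AMap S1 \<xi> = Ide B (OMap S1 (Cod X f))"
    using R0[unfolded vertical_cartesian_liftings_def, rule_format, of "Cod X f" "AMap S0 f"] arr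
    by (auto simp: cartesian_lifting_def)
  obtain i where i: "is_iso X i" "Cod X i = Dom X \<xi>" "Comp X \<xi> i = f"
    using S0.cartesian_unique_up_to_iso[OF f \<xi>(1)] \<xi> by metis
  have arrs: "\<xi> \<in> Arr X" "i \<in> Arr X"
    using \<xi> i by (auto dest: cartesian_arr simp: is_iso_def inverse_arrows_def)
  have "OMap S1 (Dom X \<xi>) = OMap S1 (Cod X f)"
    using S1.map_dom[OF arrs(1)] \<xi> arr by simp
  then have "AMap S1 f = AMap S1 i"
    using S1.map_comp[of \<xi> i] i arrs \<xi> by simp
  then show ?thesis
    using i S1.map_inverse_arrows by (auto simp: is_iso_def)
qed

text \<open>Factorizations through an \<open>S0\<close>-vertical arrow of an \<open>S0\<close>-vertical arrow are
  \<open>S0\<close>-vertical, so a fiber inherits the universal property.\<close>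

lemma opcartesian_in_fiber:
  assumes \<xi>: "opcartesian X B S1 \<xi>" and a: "a \<in> Obj A" and vert: "AMap S0 \<xi> = Ide A a"
  shows "opcartesian (fiber X A S0 a) B S1 \<xi>"
proof -
  have arr: "\<xi> \<in> Arr X" using \<xi> by (rule opcartesian_arr)
  have cod: "OMap S0 (Cod X \<xi>) = a"
    using S0.map_cod[OF arr] vert a by simp
  have vertical: "AMap S0 h = Ide A a"
    if "h \<in> Arr X" "Dom X h = Cod X \<xi>" "AMap S0 (Comp X h \<xi>) = Ide A a" for h
    using that arr vert cod by simp
  show ?thesis
    unfolding opcartesian_def fiber_simps(3-6)
  proof (intro conjI ballI impI)
    show "\<xi> \<in> Arr (fiber X A S0 a)" using arr vert by simp
    fix g \<psi> assume g: "g \<in> Arr (fiber X A S0 a)" and \<psi>: "\<psi> \<in> Arr B"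
      and g\<psi>: "Dom X g = Dom X \<xi> \<and> Dom B \<psi> = Cod B (AMap S1 \<xi>) \<and>
        AMap S1 g = Comp B \<psi> (AMap S1 \<xi>)"
    have "h \<in> Arr (fiber X A S0 a) \<and> Dom X h = Cod X \<xi> \<and> Comp X h \<xi> = g \<and> AMap S1 h = \<psi> \<longleftrightarrow>
        h \<in> Arr X \<and> Dom X h = Cod X \<xi> \<and> Comp X h \<xi> = g \<and> AMap S1 h = \<psi>" for h
      using vertical[of h] g by auto
    moreover have "\<exists>!h. h \<in> Arr X \<and> Dom X h = Cod X \<xi> \<and> Comp X h \<xi> = g \<and> AMap S1 h = \<psi>"
      by (rule \<xi>[unfolded opcartesian_def, THEN conjunct2, rule_format])
        (use g \<psi> g\<psi> in simp_all)
    ultimately show "\<exists>!h. h \<in> Arr (fiber X A S0 a) \<and> Dom X h = Cod X \<xi> \<and> Comp X h \<xi> = g \<and>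
        AMap S1 h = \<psi>"
      by simp
  qed
qed

lemma opfibration_fiber:
  assumes R1: "vertical_opcartesian_liftings X B S1 A S0" and a: "a \<in> Obj A"
  shows "opfibration (fiber X A S0 a) B S1"
  unfolding opfibration_def
proof (intro conjI ballI impI)
  show "cat_functor (fiber X A S0 a) B S1"
    using cat_functor_fiber[OF S0.cat_functor_axioms S1.cat_functor_axioms a] .
  fix x \<beta> assume "x \<in> Obj (fiber X A S0 a)" "\<beta> \<in> Arr B" "Dom B \<beta> = OMap S1 x"
  then show "\<exists>f. opcartesian_lifting (fiber X A S0 a) B S1 \<beta> x f"
    using R1 a opcartesian_in_fiber
    unfolding vertical_opcartesian_liftings_def opcartesian_lifting_def fiber_simps by metis
qed

text \<open>As \<open>S1\<close> inverts a cartesian lifting \<open>f\<close>, the opcartesian lifting of \<open>S1 f\<close> in the fiber is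
  an \<open>S0\<close>-vertical isomorphism; precomposing \<open>f\<close> with its inverse cancels \<open>S1 f\<close>.\<close>

lemma vertical_cartesian_liftingsI:
  assumes fib: "fibration X A S0"
    and iso: "\<And>f. cartesian X A S0 f \<Longrightarrow> is_iso B (AMap S1 f)"
    and opfib: "\<And>a. a \<in> Obj A \<Longrightarrow> opfibration (fiber X A S0 a) B S1"
  shows "vertical_cartesian_liftings X A S0 B S1"
  unfolding vertical_cartesian_liftings_def
proof (intro ballI impI)
  fix x \<alpha> assume x: "x \<in> Obj X" "\<alpha> \<in> Arr A" "Cod A \<alpha> = OMap S0 x"
  obtain f where f: "cartesian X A S0 f" "Cod X f = x" "AMap S0 f = \<alpha>"
    using fib x by (auto simp: fibration_def cartesian_lifting_def)
  have arr: "f \<in> Arr X" using f by (auto dest: cartesian_arr)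
  let ?a = "OMap S0 (Dom X f)"
  have a: "?a \<in> Obj A" using arr by simp
  obtain \<tau> where \<tau>: "inverse_arrows B (AMap S1 f) \<tau>"
    using iso[OF f(1)] by (auto simp: is_iso_def)
  interpret Fib: cat_functor "op_cat (fiber X A S0 ?a)" "op_cat B" S1
    using cat_functor_fiber[OF S0.cat_functor_axioms S1.cat_functor_axioms a] by simp
  obtain \<rho> where \<rho>: "opcartesian (fiber X A S0 ?a) B S1 \<rho>" "Dom X \<rho> = Dom X f"
      "AMap S1 \<rho> = AMap S1 f"
    using opfibration_lifting[OF opfib[OF a], of "Dom X f" "AMap S1 f"] arr
    by (auto simp: opcartesian_lifting_def)
  obtain \<sigma> where \<sigma>: "inverse_arrows (fiber X A S0 ?a) \<rho> \<sigma>" "AMap S1 \<sigma> = \<tau>"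
    using Fib.inverse_arrows_if_cartesian_over_iso[of \<rho> \<tau>] \<rho> \<tau> by auto
  have \<sigma>\<rho>: "inverse_arrows X \<sigma> \<rho>" "\<sigma> \<in> Arr X" "AMap S0 \<sigma> = Ide A ?a" "Cod X \<sigma> = Dom X f"
    using \<sigma> \<rho> by (auto simp: inverse_arrows_def)
  have "cartesian X A S0 (Comp X f \<sigma>)"
    using S0.cartesian_comp_iso[OF f(1) \<sigma>\<rho>(1,4)] .
  moreover have "AMap S0 (Comp X f \<sigma>) = \<alpha>"
    using \<sigma>\<rho> arr f(3)[symmetric] by simp
  moreover have "AMap S1 (Comp X f \<sigma>) = Ide B (OMap S1 x)"
    using \<sigma>\<rho> \<sigma> arr f \<tau> by (auto simp: inverse_arrows_def)
  ultimately show "\<exists>f. cartesian_lifting X A S0 \<alpha> x f \<and> AMap S1 f = Ide B (OMap S1 x)"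
    using f arr \<sigma>\<rho> by (auto simp: cartesian_lifting_def)
qed

text \<open>An arrow \<open>g\<close> out of the domain of \<open>\<xi>\<close> is split as \<open>\<kappa> \<cdot> g'\<close> with \<open>\<kappa>\<close> an \<open>S1\<close>-vertical
  cartesian lifting of \<open>S0 g\<close>. Then \<open>g'\<close> lies in the fiber and has the same image under \<open>S1\<close> as \<open>g\<close>,
  so it factors through \<open>\<xi>\<close> there; and every factorization of \<open>g\<close> through \<open>\<xi>\<close> arises in this way,
  because it lies over \<open>S0 g\<close> as well.\<close>

lemma opcartesian_if_opcartesian_in_fiber:
  assumes R0: "vertical_cartesian_liftings X A S0 B S1" and a: "a \<in> Obj A"
    and \<xi>: "opcartesian (fiber X A S0 a) B S1 \<xi>"
  shows "opcartesian X B S1 \<xi>"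
  unfolding opcartesian_def
proof (intro conjI ballI impI)
  have arr: "\<xi> \<in> Arr X" and vert: "AMap S0 \<xi> = Ide A a"
    using \<xi> by (auto dest: opcartesian_arr)
  have dom: "OMap S0 (Dom X \<xi>) = a" and cod: "OMap S0 (Cod X \<xi>) = a"
    using S0.map_dom[OF arr] S0.map_cod[OF arr] vert a by simp_all
  show "\<xi> \<in> Arr X" by (fact arr)
  fix g \<psi> assume g: "g \<in> Arr X" and \<psi>: "\<psi> \<in> Arr B"
    and g\<psi>: "Dom X g = Dom X \<xi> \<and> Dom B \<psi> = Cod B (AMap S1 \<xi>) \<and>
      AMap S1 g = Comp B \<psi> (AMap S1 \<xi>)"
  let ?\<gamma> = "AMap S0 g"
  obtain \<kappa> where \<kappa>: "cartesian X A S0 \<kappa>" "Cod X \<kappa> = Cod X g" "AMap S0 \<kappa> = ?\<gamma>"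
      "AMap S1 \<kappa> = Ide B (OMap S1 (Cod X g))"
    using R0[unfolded vertical_cartesian_liftings_def, rule_format, of "Cod X g" ?\<gamma>] g
    by (auto simp: cartesian_lifting_def)
  have \<kappa>_arr: "\<kappa> \<in> Arr X" using \<kappa> by (auto dest: cartesian_arr)
  have dom_\<kappa>0: "OMap S0 (Dom X \<kappa>) = a"
    using S0.map_dom[OF \<kappa>_arr] \<kappa> g g\<psi> dom by simp
  have dom_\<kappa>1: "OMap S1 (Dom X \<kappa>) = OMap S1 (Cod X g)"
    using S1.map_dom[OF \<kappa>_arr] \<kappa> g by simp
  have S1_\<kappa>: "AMap S1 (Comp X \<kappa> k) = AMap S1 k" if "k \<in> Arr X" "Cod X k = Dom X \<kappa>" for k
    using that \<kappa>_arr \<kappa> dom_\<kappa>1 by simp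
  obtain g' where g': "g' \<in> Arr X" "Dom X g' = Dom X \<xi>" "Cod X g' = Dom X \<kappa>" "Comp X \<kappa> g' = g"
      "AMap S0 g' = Ide A a"
    using S0.cartesian_factor[OF \<kappa>(1) g, of "Ide A a"] \<kappa> g g\<psi> a dom dom_\<kappa>0 by auto
  have S1_g': "AMap S1 g' = Comp B \<psi> (AMap S1 \<xi>)"
    using S1_\<kappa>[of g'] g' g\<psi> by simp
  have "\<exists>!h. h \<in> Arr (fiber X A S0 a) \<and> Dom X h = Cod X \<xi> \<and> Comp X h \<xi> = g' \<and> AMap S1 h = \<psi>"
    by (rule \<xi>[unfolded opcartesian_def fiber_simps(3-6), THEN conjunct2, rule_format])
      (use \<psi> g' S1_g' g\<psi> in simp_all)
  then obtain h where h: "h \<in> Arr X" "AMap S0 h = Ide A a" "Dom X h = Cod X \<xi>"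
      "Comp X h \<xi> = g'" "AMap S1 h = \<psi>"
    and h_unique: "\<And>k. \<lbrakk>k \<in> Arr X; AMap S0 k = Ide A a; Dom X k = Cod X \<xi>; Comp X k \<xi> = g';
      AMap S1 k = \<psi>\<rbrakk> \<Longrightarrow> k = h"
    unfolding fiber_simps by (blast elim: ex1E)
  have cod_h: "Cod X h = Dom X \<kappa>" using S0.X.cod_comp[of h \<xi>] h arr g' by simp
  show "\<exists>!h. h \<in> Arr X \<and> Dom X h = Cod X \<xi> \<and> Comp X h \<xi> = g \<and> AMap S1 h = \<psi>"
  proof (rule ex1I[of _ "Comp X \<kappa> h"])
    show "Comp X \<kappa> h \<in> Arr X \<and> Dom X (Comp X \<kappa> h) = Cod X \<xi> \<and> Comp X (Comp X \<kappa> h) \<xi> = g \<and>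
        AMap S1 (Comp X \<kappa> h) = \<psi>"
      using h cod_h \<kappa>_arr arr g' S0.X.comp_assoc[of \<kappa> h \<xi>] S1_\<kappa>[of h] by simp
  next
    fix k assume "k \<in> Arr X \<and> Dom X k = Cod X \<xi> \<and> Comp X k \<xi> = g \<and> AMap S1 k = \<psi>"
    then have k: "k \<in> Arr X" "Dom X k = Cod X \<xi>" "Comp X k \<xi> = g" "AMap S1 k = \<psi>" by auto
    have cod_k: "Cod X k = Cod X \<kappa>" using S0.X.cod_comp[of k \<xi>] k arr \<kappa> by simp
    have "AMap S0 k = ?\<gamma>" using S0.map_comp[of k \<xi>] k arr vert cod by simp
    then obtain k' where k': "k' \<in> Arr X" "Dom X k' = Cod X \<xi>" "Cod X k' = Dom X \<kappa>"
        "Comp X \<kappa> k' = k" "AMap S0 k' = Ide A a"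
      using S0.cartesian_factor[OF \<kappa>(1) k(1) cod_k, of "Ide A a"] \<kappa> \<kappa>_arr k g a dom_\<kappa>0 g\<psi> dom
      by auto
    have "Comp X k' \<xi> = g'"
    proof (rule S0.cartesian_cancel[OF \<kappa>(1)])
      show "Comp X \<kappa> (Comp X k' \<xi>) = Comp X \<kappa> g'"
        using k k' g' arr \<kappa>_arr S0.X.comp_assoc[of \<kappa> k' \<xi>] by simp
    qed (use k' g' arr vert a in auto)
    then have "k' = h" using h_unique[of k'] k' k S1_\<kappa>[of k'] by simp
    then show "k = Comp X \<kappa> h" using k' by simp
  qed
qed

theorem vertical_liftings_iff:
  "vertical_cartesian_liftings X A S0 B S1 \<and> vertical_opcartesian_liftings X B S1 A S0 \<longleftrightarrow>
    fibration X A S0 \<and> (\<forall>f. cartesian X A S0 f \<longrightarrow> is_iso B (AMap S1 f)) \<and>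
    (\<forall>a\<in>Obj A. opfibration (fiber X A S0 a) B S1)" (is "?reg \<longleftrightarrow> ?fib")
proof
  assume reg: ?reg
  then have "fibration X A S0"
    using S0.cat_functor_axioms unfolding fibration_def vertical_cartesian_liftings_def by blast
  then show ?fib using reg iso_if_cartesian opfibration_fiber by blast
next
  assume fib: ?fib
  then have R0: "vertical_cartesian_liftings X A S0 B S1"
    using vertical_cartesian_liftingsI by blast
  have "\<exists>\<xi>. opcartesian_lifting X B S1 \<beta> x \<xi> \<and> AMap S0 \<xi> = Ide A (OMap S0 x)"
    if x: "x \<in> Obj X" "\<beta> \<in> Arr B" "Dom B \<beta> = OMap S1 x" for x \<beta>
  proof -
    have a: "OMap S0 x \<in> Obj A" using x by simp
    then obtain \<xi> where \<xi>: "opcartesian (fiber X A S0 (OMap S0 x)) B S1 \<xi>" "Dom X \<xi> = x"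
        "AMap S1 \<xi> = \<beta>"
      using fib opfibration_lifting[of "fiber X A S0 (OMap S0 x)" B S1 x \<beta>] x
      by (auto simp: opcartesian_lifting_def)
    show ?thesis
      using opcartesian_if_opcartesian_in_fiber[OF R0 a \<xi>(1)] opcartesian_arr[OF \<xi>(1)] \<xi>
      by (auto simp: opcartesian_lifting_def)
  qed
  then show ?reg using R0 by (simp add: vertical_opcartesian_liftings_def)
qed

end

section \<open>Spans into a product\<close>

lemma (in category_product) vertical_liftings_iff_fiberwise_opfibration:
  assumes S: "cat_functor X M S"
  shows "vertical_cartesian_liftings X A (P \<cdot>\<^sub>F S) B (Q \<cdot>\<^sub>F S) \<and>
      vertical_opcartesian_liftings X B (Q \<cdot>\<^sub>F S) A (P \<cdot>\<^sub>F S) \<longleftrightarrow>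
    fib_morphism A X (P \<cdot>\<^sub>F S) M P S \<and> fiberwise_opfibration A X (P \<cdot>\<^sub>F S) M P S"
proof -
  interpret span X A B "P \<cdot>\<^sub>F S" "Q \<cdot>\<^sub>F S"
    using cat_functor_comp[OF S P.cat_functor_axioms] cat_functor_comp[OF S Q.cat_functor_axioms]
    by (rule span.intro)
  have "cartesian M A P (AMap S f) \<longleftrightarrow> is_iso B (AMap (Q \<cdot>\<^sub>F S) f)"
    if "cartesian X A (P \<cdot>\<^sub>F S) f" for f
    using cartesian_arr[OF that] cat_functor.map_arr[OF S] by (simp add: cartesian_iff)
  then have "fib_morphism A X (P \<cdot>\<^sub>F S) M P S \<longleftrightarrow> fibration X A (P \<cdot>\<^sub>F S) \<and>
      (\<forall>f. cartesian X A (P \<cdot>\<^sub>F S) f \<longrightarrow> is_iso B (AMap (Q \<cdot>\<^sub>F S) f))"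
    using S fibration_proj by (auto simp: fib_morphism_def func_eq_def)
  then show ?thesis
    unfolding vertical_liftings_iff fiberwise_opfibration_def
    using opfibration_fiber_iff[OF S] by auto
qed

theorem proposition2p2:
  fixes X :: "('o, 'm) cat" and A :: "('p, 'n) cat" and B :: "('q, 'k) cat"
    and S :: "('o, 'm, 'p \<times> 'q, 'n \<times> 'k) func"
    and S0 :: "('o, 'm, 'p, 'n) func" and S1 :: "('o, 'm, 'q, 'k) func"
  assumes "category X" and "category A" and "category B"
    and "cat_functor X (A \<times>\<^sub>C B) S"
    and "S0 = Pr0 \<cdot>\<^sub>F S" and "S1 = Pr1 \<cdot>\<^sub>F S"
  shows "(regular_span X A B S \<longleftrightarrow>
      fib_morphism A X S0 (A \<times>\<^sub>C B) Pr0 S \<and> fiberwise_opfibration A X S0 (A \<times>\<^sub>C B) Pr0 S) \<and>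
    (regular_span X A B S \<longleftrightarrow>
      opfib_morphism B X S1 (A \<times>\<^sub>C B) Pr1 S \<and> fiberwise_fibration B X S1 (A \<times>\<^sub>C B) Pr1 S)"
proof -
  interpret prod: category_product "A \<times>\<^sub>C B" A B Pr0 Pr1
    using assms by (intro category_product_prod_cat)
  \<comment> \<open>The second equivalence is the first one for the opposite span with its legs swapped.\<close>
  interpret op: category_product "op_cat (A \<times>\<^sub>C B)" "op_cat B" "op_cat A" Pr1 Pr0
    by (rule prod.op_category_product)
  have "regular_span X A B S \<longleftrightarrow>
      vertical_cartesian_liftings X A S0 B S1 \<and> vertical_opcartesian_liftings X B S1 A S0"
    using assms(4)
    unfolding regular_span_def Let_def assms(5,6) vertical_cartesian_liftings_def
      vertical_opcartesian_liftings_def cartesian_lifting_def opcartesian_lifting_def conj_assoc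
    by blast
  then show ?thesis
    using prod.vertical_liftings_iff_fiberwise_opfibration[OF assms(4)]
      op.vertical_liftings_iff_fiberwise_opfibration[of "op_cat X" S] assms(4-6)
    by auto
qed

end
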